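(* Let $E$ be a real Banach space partially ordered by a cone $K$, and let $A\colon K\to K$ be a monotone operator that is strongly concave on $K$. Assume that there exists $x^*\in K$, $x^*\neq\theta$, such that $Ax^*=x^*$. Then for any $r_1\in(0,1)$ and $r_2>1$ the operator $A$ has no fixed points other than $x^*$ in the conical segment $\langle r_1x^*, r_2x^*\rangle$.
   Context: $E$ is a real Banach space with zero element $\theta$. A cone $K\subset E$ is a nonempty closed convex set with $tK\subset K$ for all $t\ge0$ and $K\cap(-K)=\{\theta\}$; it induces the partial order $x\le y \iff y-x\in K$. Neither normality of $K$ nor continuity of $A$ is assumed. For $u\le v$, the conical segment is $\langle u,v\rangle=\{x\in E: u\le x\le v\}$. An operator $A\colon K\to K$ is monotone if $x\le y$ implies $Ax\le Ay$. A monotone operator $A$ is strongly concave on $K$ if there exists a continuous, monotonically (strictly) increasing concave mapping $\varphi\colon[0,1]\to[0,1]$ with $\varphi(0)=0$, $\varphi(1)=1$, $\varphi'(+0)=+\infty$ (i.e. $\varphi(\tau)/\tau\to+\infty$ as $\tau\to0+$) such that $A(\sigma u)\ge\varphi(\sigma)Au$ for all $u\in K$, $\sigma\in[0,1]$. *)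

theory Defs
  imports "HOL-Analysis.Analysis"
begin

definition order_cone :: "'a::real_normed_vector set \<Rightarrow> bool" where
  "order_cone K \<longleftrightarrow> closed K \<and> convex_cone K \<and> K \<inter> uminus ` K = {0}"

definition cone_le :: "'a::real_normed_vector set \<Rightarrow> 'a \<Rightarrow> 'a \<Rightarrow> bool" where
  "cone_le K x y \<longleftrightarrow> y - x \<in> K"

definition conical_segment :: "'a::real_normed_vector set \<Rightarrow> 'a \<Rightarrow> 'a \<Rightarrow> 'a set" where
  "conical_segment K u v = {x. cone_le K u x \<and> cone_le K x v}"

text \<open>Monotonicity of the operator is not part of the following predicate; it is expressed
  separately by \<open>monotone_on K (cone_le K) (cone_le K) A\<close>.\<close>

definition strongly_concave :: "'a::real_normed_vector set \<Rightarrow> ('a \<Rightarrow> 'a) \<Rightarrow> bool" where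
  "strongly_concave K A \<longleftrightarrow>
    (\<exists>\<phi>::real \<Rightarrow> real.
      \<phi> \<in> {0..1} \<rightarrow> {0..1} \<and> continuous_on {0..1} \<phi> \<and>
      strict_mono_on {0..1} \<phi> \<and> concave_on {0..1} \<phi> \<and>
      \<phi> 0 = 0 \<and> \<phi> 1 = 1 \<and>
      filterlim (\<lambda>\<tau>. \<phi> \<tau> / \<tau>) at_top (at_right 0) \<and>
      (\<forall>u\<in>K. \<forall>\<sigma>\<in>{0..1}. cone_le K (\<phi> \<sigma> *\<^sub>R A u) (A (\<sigma> *\<^sub>R u))))"

end

theory Submission
  imports Defs
begin

text \<open>
  Two fixed points, each dominating a positive multiple of the other, must coincide. The reason is that
  the modulus \<open>\<phi>\<close> of strong concavity lies strictly above the diagonal on \<open>(0,1)\<close>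
  (\<open>concave_above_diagonal\<close>): it lies weakly above by concavity, and touching the diagonal at an
  interior point would force \<open>\<phi> \<tau> \<le> \<tau>\<close> near \<open>0\<close>, against the infinite slope there.

  Let \<open>u\<close> and \<open>v\<close> be fixed points such that \<open>u\<close> dominates a positive multiple of \<open>v\<close>, and take the
  largest \<open>m \<in> [0,1]\<close> with \<open>m v \<le> u\<close>; it exists because the cone is closed. If \<open>m < 1\<close>, then
  \<open>u = A u \<ge> A (m v) \<ge> \<phi> m \<cdot> A v = \<phi> m \<cdot> v\<close> with \<open>\<phi> m > m\<close>, which is absurd. So \<open>m = 1\<close>, that is,
  \<open>v \<le> u\<close> (\<open>fixed_point_dominates\<close>). For a fixed point \<open>x\<close> with \<open>r\<^sub>1 x\<^sup>* \<le> x \<le> r\<^sub>2 x\<^sup>*\<close> this applies to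
  both orders of the pair, with the factors \<open>r\<^sub>1\<close> and \<open>1 / r\<^sub>2\<close>, and the cone order is antisymmetric.
\<close>

lemma order_cone_scale: "order_cone K \<Longrightarrow> x \<in> K \<Longrightarrow> 0 \<le> c \<Longrightarrow> c *\<^sub>R x \<in> K"
  by (auto simp: order_cone_def convex_cone_def conic_def)

lemma order_cone_add: "order_cone K \<Longrightarrow> x \<in> K \<Longrightarrow> y \<in> K \<Longrightarrow> x + y \<in> K"
  by (simp add: order_cone_def convex_cone_add)

lemma cone_le_trans:
  assumes "order_cone K" "cone_le K x y" "cone_le K y z"
  shows "cone_le K x z"
  using order_cone_add[of K "y - x" "z - y"] assms by (simp add: cone_le_def)

lemma cone_le_antisym:
  assumes "order_cone K" "cone_le K x y" "cone_le K y x"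
  shows "x = y"
proof -
  have "y - x \<in> K \<inter> uminus ` K"
    using assms(2,3) by (force simp: cone_le_def intro: image_eqI[of _ _ "x - y"])
  with assms(1) show ?thesis by (auto simp: order_cone_def)
qed

text \<open>If \<open>\<phi> s \<le> s\<close> at an interior point \<open>s\<close>, then for \<open>\<tau> < s\<close> the point \<open>(s, \<phi> s)\<close> lies above the chord
  from \<open>(\<tau>, \<phi> \<tau>)\<close> to \<open>(1, 1)\<close>, which pushes \<open>\<phi> \<tau>\<close> down to at most \<open>\<tau>\<close>; the difference quotient at
  \<open>0\<close> then stays bounded.\<close>

lemma concave_above_diagonal:
  fixes \<phi> :: "real \<Rightarrow> real"
  assumes concave: "concave_on {0..1} \<phi>" and one: "\<phi> 1 = 1"
    and slope: "filterlim (\<lambda>\<tau>. \<phi> \<tau> / \<tau>) at_top (at_right 0)"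
    and s: "0 < s" "s < 1"
  shows "s < \<phi> s"
proof (rule ccontr)
  assume "\<not> s < \<phi> s"
  then have le: "\<phi> s \<le> s" by simp
  have below: "\<phi> \<tau> \<le> \<tau>" if \<tau>: "0 < \<tau>" "\<tau> < s" for \<tau>
  proof -
    define t where "t = (s - \<tau>) / (1 - \<tau>)"
    have t: "0 \<le> t" "t < 1" and "t * (1 - \<tau>) = s - \<tau>"
      using \<tau> s by (auto simp: t_def)
    then have comb: "(1 - t) * \<tau> + t = s"
      by (simp add: algebra_simps)
    have "(1 - t) * \<phi> \<tau> + t * \<phi> 1 \<le> \<phi> ((1 - t) *\<^sub>R \<tau> + t *\<^sub>R 1)"
      using concave_onD[OF concave, of t \<tau> 1] t \<tau> s by simp
    then have "(1 - t) * \<phi> \<tau> \<le> (1 - t) * \<tau>"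
      using comb le one by simp
    then show ?thesis using t by simp
  qed
  have "eventually (\<lambda>\<tau>. 2 \<le> \<phi> \<tau> / \<tau>) (at_right 0)"
    using slope by (simp add: filterlim_at_top)
  moreover have "eventually (\<lambda>\<tau>. \<tau> \<in> {0<..<s}) (at_right (0::real))"
    using s by (intro eventually_at_right_real)
  ultimately have "eventually (\<lambda>\<tau>::real. False) (at_right 0)"
  proof eventually_elim
    case (elim \<tau>)
    then have "2 * \<tau> \<le> \<phi> \<tau>" by (simp add: field_simps)
    with below[of \<tau>] elim show False by auto
  qed
  then show False by simp
qed

lemma fixed_point_dominates:
  fixes K :: "'a::real_normed_vector set"
  assumes K: "order_cone K"
    and mono: "monotone_on K (cone_le K) (cone_le K) A"
    and A: "strongly_concave K A"
    and u: "u \<in> K" "A u = u" and v: "v \<in> K" "A v = v"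
    and c: "0 < c" "c \<le> 1" "cone_le K (c *\<^sub>R v) u"
  shows "cone_le K v u"
proof -
  obtain \<phi> :: "real \<Rightarrow> real" where
    range: "\<phi> \<in> {0..1} \<rightarrow> {0..1}" and concave: "concave_on {0..1} \<phi>" and one: "\<phi> 1 = 1"
    and slope: "filterlim (\<lambda>\<tau>. \<phi> \<tau> / \<tau>) at_top (at_right 0)"
    and scale: "\<And>x \<sigma>. x \<in> K \<Longrightarrow> \<sigma> \<in> {0..1} \<Longrightarrow> cone_le K (\<phi> \<sigma> *\<^sub>R A x) (A (\<sigma> *\<^sub>R x))"
    using A unfolding strongly_concave_def by blast
  define S where "S = {0..1} \<inter> (\<lambda>s. u - s *\<^sub>R v) -` K"
  have "closed ((\<lambda>s. u - s *\<^sub>R v) -` K)"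
    using K by (intro closed_vimage continuous_intros) (auto simp: order_cone_def)
  then have "compact S"
    unfolding S_def by (intro compact_Int_closed) auto
  moreover have cS: "c \<in> S"
    using c by (auto simp: S_def cone_le_def)
  ultimately obtain m where m: "m \<in> S" and max: "\<And>s. s \<in> S \<Longrightarrow> s \<le> m"
    using compact_attains_sup[of S] by blast
  have "0 < m" using max[OF cS] c by simp
  have m01: "m \<in> {0..1}" and mu: "cone_le K (m *\<^sub>R v) u"
    using m by (auto simp: S_def cone_le_def)
  have "m = 1"
  proof (rule ccontr)
    assume "m \<noteq> 1"
    then have less: "m < \<phi> m"
      using concave_above_diagonal[OF concave one slope] \<open>0 < m\<close> m01 by simp
    have "cone_le K (A (m *\<^sub>R v)) u"
      using monotone_onD[OF mono _ u(1) mu] order_cone_scale[OF K v(1)] m01 u(2) by simp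
    then have "cone_le K (\<phi> m *\<^sub>R v) u"
      using cone_le_trans[OF K scale[OF v(1) m01]] v(2) by simp
    moreover have "\<phi> m \<in> {0..1}"
      using range m01 by blast
    ultimately have "\<phi> m \<in> S"
      by (simp add: S_def cone_le_def)
    with max less show False by fastforce
  qed
  with mu show ?thesis by simp
qed

theorem theorem7:
  fixes K :: "'a::banach set" and A :: "'a \<Rightarrow> 'a" and xs :: 'a and r1 r2 :: real
  assumes "order_cone K"
    and "A \<in> K \<rightarrow> K"
    and "monotone_on K (cone_le K) (cone_le K) A"
    and "strongly_concave K A"
    and "xs \<in> K" and "xs \<noteq> 0" and "A xs = xs"
    and "r1 \<in> {0<..<1}" and "r2 > 1"
  shows "\<not> (\<exists>x \<in> conical_segment K (r1 *\<^sub>R xs) (r2 *\<^sub>R xs). A x = x \<and> x \<noteq> xs)"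
proof -
  have "x = xs" if seg: "x \<in> conical_segment K (r1 *\<^sub>R xs) (r2 *\<^sub>R xs)" and fix_x: "A x = x" for x
  proof -
    have lower: "cone_le K (r1 *\<^sub>R xs) x" and upper: "cone_le K x (r2 *\<^sub>R xs)"
      using seg by (auto simp: conical_segment_def)
    have "x \<in> K"
      using order_cone_add[OF assms(1) order_cone_scale[OF assms(1,5), of r1], of "x - r1 *\<^sub>R xs"]
        lower assms(8) by (simp add: cone_le_def)
    have "cone_le K ((1 / r2) *\<^sub>R x) xs"
      using order_cone_scale[OF assms(1), of "r2 *\<^sub>R xs - x" "1 / r2"] upper assms(9)
      by (simp add: cone_le_def scaleR_diff_right)
    then have "cone_le K x xs"
      using fixed_point_dominates[OF assms(1,3,4,5,7) \<open>x \<in> K\<close> fix_x, of "1 / r2"] assms(9) by simp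
    moreover have "cone_le K xs x"
      using fixed_point_dominates[OF assms(1,3,4) \<open>x \<in> K\<close> fix_x assms(5,7), of r1] lower assms(8)
      by simp
    ultimately show "x = xs"
      by (rule cone_le_antisym[OF assms(1)])
  qed
  then show ?thesis by blast
qed

end
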